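(* Let $\{X_n\}_{n\ge 0}$ be a finite irreducible discrete time Markov chain with state space $\mathcal S=\{1,\dots,m\}$, transition matrix $P$ and stationary distribution $\{\pi_j\}$. For $i\in\mathcal S$ let $f_i(s)=\sum_{n=0}^\infty P\{T_i^{(0)}=n\mid X_0=i\}s^n$ and $g_i(s)=\sum_{n=0}^\infty P\{T_i^{(1)}=n\mid X_0=i\}s^n$ be the probability generating functions of the mixing times. Then for $|s|<1$, $$f_i(s)=\sum_{j=1}^m\pi_j\left[\frac{P_{ij}(s)}{P_{jj}(s)}\right],\qquad g_i(s)=f_i(s)-\frac{\pi_i}{P_{ii}(s)}.$$
   Context: The mixing variable $M$ is a random variable, independent of the chain, with $P[M=j]=\pi_j$ for all $j\in\mathcal S$. Given $X_0=i$, $T_i^{(0)}=\min\{n\ge 0: X_n=M\}$ and $T_i^{(1)}=\min\{n\ge 1: X_n=M\}$. $P_{ij}(s)=\sum_{n=0}^\infty p_{ij}^{(n)}s^n$, where $p_{ij}^{(n)}=P\{X_n=j\mid X_0=i\}$ (so $p_{ij}^{(0)}=\delta_{ij}$). *)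

theory Defs
  imports "HOL-Probability.Probability"
begin

definition stochastic_matrix :: "nat \<Rightarrow> (nat \<Rightarrow> nat \<Rightarrow> real) \<Rightarrow> bool" where
  "stochastic_matrix m P \<longleftrightarrow>
     (\<forall>i\<in>{1..m}. (\<forall>j\<in>{1..m}. 0 \<le> P i j) \<and> (\<Sum>j=1..m. P i j) = 1)"

text \<open>
  The initial distribution, i.e. the law of \<open>X 0\<close>, is arbitrary.  The Markov property only
  concerns histories of positive probability, those on which one can condition.
\<close>

definition markov_chain ::
  "'w measure \<Rightarrow> nat \<Rightarrow> (nat \<Rightarrow> nat \<Rightarrow> real) \<Rightarrow> (nat \<Rightarrow> 'w \<Rightarrow> nat) \<Rightarrow> bool" where
  "markov_chain \<Omega> m P X \<longleftrightarrow>
     prob_space \<Omega> \<and> stochastic_matrix m P \<and>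
     (\<forall>n. X n \<in> measurable \<Omega> (count_space {1..m})) \<and>
     (\<forall>n x. \<forall>j\<in>{1..m}. \<P>(\<omega> in \<Omega>. \<forall>k\<le>n. X k \<omega> = x k) > 0 \<longrightarrow>
        \<P>(\<omega> in \<Omega>. X (Suc n) \<omega> = j \<bar> \<forall>k\<le>n. X k \<omega> = x k) = P (x n) j)"

text \<open>
  The \<open>n\<close>-step transition probability \<open>p\<^sub>i\<^sub>j\<^sup>(\<^sup>n\<^sup>) = P{X\<^sub>n = j | X\<^sub>0 = i}\<close>.  As the initial distribution
  may give probability \<open>0\<close> to some states \<open>i\<close>, we use homogeneity in time and condition on
  \<open>X\<^sub>k = i\<close> for the first time \<open>k\<close> at which this event has positive probability.  Thus \<open>k = 0\<close>
  whenever conditioning on \<open>X\<^sub>0 = i\<close> is meaningful; see \<open>trans_prob_initial\<close>.  If there is no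
  such \<open>k\<close>, the value is \<open>0\<close>, which cannot happen for an irreducible chain.
\<close>

definition trans_prob ::
  "'w measure \<Rightarrow> (nat \<Rightarrow> 'w \<Rightarrow> nat) \<Rightarrow> nat \<Rightarrow> nat \<Rightarrow> nat \<Rightarrow> real" where
  "trans_prob \<Omega> X n i j =
     (let k = (LEAST k. \<P>(\<omega> in \<Omega>. X k \<omega> = i) > 0)
      in \<P>(\<omega> in \<Omega>. X (k + n) \<omega> = j \<bar> X k \<omega> = i))"

lemma trans_prob_initial:
  assumes "\<P>(\<omega> in \<Omega>. X 0 \<omega> = i) > 0"
  shows "trans_prob \<Omega> X n i j = \<P>(\<omega> in \<Omega>. X n \<omega> = j \<bar> X 0 \<omega> = i)"
proof -
  have "(LEAST k. \<P>(\<omega> in \<Omega>. X k \<omega> = i) > 0) = 0"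
    using assms by (rule Least_eq_0)
  then show ?thesis
    unfolding trans_prob_def by simp
qed

definition irreducible_chain :: "'w measure \<Rightarrow> nat \<Rightarrow> (nat \<Rightarrow> 'w \<Rightarrow> nat) \<Rightarrow> bool" where
  "irreducible_chain \<Omega> m X \<longleftrightarrow>
     (\<forall>i\<in>{1..m}. \<forall>j\<in>{1..m}. \<exists>n. trans_prob \<Omega> X n i j > 0)"

definition stationary_distribution ::
  "nat \<Rightarrow> (nat \<Rightarrow> nat \<Rightarrow> real) \<Rightarrow> (nat \<Rightarrow> real) \<Rightarrow> bool" where
  "stationary_distribution m P \<pi> \<longleftrightarrow>
     (\<forall>j\<in>{1..m}. 0 \<le> \<pi> j) \<and> (\<Sum>j=1..m. \<pi> j) = 1 \<and>
     (\<forall>j\<in>{1..m}. (\<Sum>i=1..m. \<pi> i * P i j) = \<pi> j)"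

text \<open>
  The generated sigma-algebras of \<open>M\<close> and of the whole process are independent.  (The library's
  \<open>indep_var\<close> needs random variables of one and the same type.)
\<close>

definition mixing_variable ::
  "'w measure \<Rightarrow> nat \<Rightarrow> (nat \<Rightarrow> 'w \<Rightarrow> nat) \<Rightarrow> (nat \<Rightarrow> real) \<Rightarrow> ('w \<Rightarrow> nat) \<Rightarrow> bool" where
  "mixing_variable \<Omega> m X \<pi> M \<longleftrightarrow>
     M \<in> measurable \<Omega> (count_space {1..m}) \<and>
     (\<forall>j\<in>{1..m}. \<P>(\<omega> in \<Omega>. M \<omega> = j) = \<pi> j) \<and>
     prob_space.indep_set \<Omega>
       (sets (vimage_algebra (space \<Omega>) M (count_space {1..m})))
       (sets (vimage_algebra (space \<Omega>) (\<lambda>\<omega> n. X n \<omega>)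
         (Pi\<^sub>M UNIV (\<lambda>_::nat. count_space {1..m}))))"

text \<open>
  \<open>mixing_time X M r\<close> is \<open>T\<^sup>(\<^sup>r\<^sup>)\<close> for \<open>r = 0, 1\<close>, with value \<open>\<infinity>\<close> if the chain never hits \<open>M\<close>
  from time \<open>r\<close> on.  The starting state enters only through conditioning on \<open>X\<^sub>0 = i\<close>.
\<close>

definition mixing_time :: "(nat \<Rightarrow> 'w \<Rightarrow> nat) \<Rightarrow> ('w \<Rightarrow> nat) \<Rightarrow> nat \<Rightarrow> 'w \<Rightarrow> enat" where
  "mixing_time X M r \<omega> = Inf {enat n |n. r \<le> n \<and> X n \<omega> = M \<omega>}"

definition mixing_pgf ::
  "'w measure \<Rightarrow> (nat \<Rightarrow> 'w \<Rightarrow> nat) \<Rightarrow> ('w \<Rightarrow> nat) \<Rightarrow> nat \<Rightarrow> nat \<Rightarrow>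
   'a::{real_normed_field, banach} \<Rightarrow> 'a" where
  "mixing_pgf \<Omega> X M r i s =
     (\<Sum>n. of_real \<P>(\<omega> in \<Omega>. mixing_time X M r \<omega> = enat n \<bar> X 0 \<omega> = i) * s ^ n)"

definition trans_gf ::
  "'w measure \<Rightarrow> (nat \<Rightarrow> 'w \<Rightarrow> nat) \<Rightarrow> nat \<Rightarrow> nat \<Rightarrow> 'a::{real_normed_field, banach} \<Rightarrow> 'a" where
  "trans_gf \<Omega> X i j s = (\<Sum>n. of_real (trans_prob \<Omega> X n i j) * s ^ n)"

end

theory Submission
  imports Defs
begin

text \<open>
  Conditioning on \<open>M = j\<close> turns the mixing time into a first-passage time to the fixed state \<open>j\<close>,
  whose generating function is \<open>F\<^sub>i\<^sub>j(s)\<close>.  Decomposing a visit to \<open>j\<close> according to the first visit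
  at a time \<open>\<ge> r\<close> gives \<open>P\<^sub>i\<^sub>j(s) = F\<^sub>i\<^sub>j(s) P\<^sub>j\<^sub>j(s)\<close> for \<open>r = 0\<close> and
  \<open>P\<^sub>i\<^sub>j(s) = \<delta>\<^sub>i\<^sub>j + F\<^sub>i\<^sub>j(s) P\<^sub>j\<^sub>j(s)\<close> for \<open>r = 1\<close>.  The latter with \<open>i = j\<close> also shows
  \<open>P\<^sub>j\<^sub>j(s) \<noteq> 0\<close>.
\<close>

text \<open>Matrix powers give the \<open>n\<close>-step probabilities a form free of any reference
  time, whereas \<open>trans_prob\<close> conditions at a time picked by
  \<open>LEAST\<close>.\<close>

fun matrix_pow :: "nat \<Rightarrow> (nat \<Rightarrow> nat \<Rightarrow> real) \<Rightarrow> nat \<Rightarrow> nat \<Rightarrow> nat \<Rightarrow> real" where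
  "matrix_pow m P 0 i j = (if i = j then 1 else 0)"
| "matrix_pow m P (Suc n) i j = (\<Sum>k=1..m. matrix_pow m P n i k * P k j)"

section \<open>The Markov property for whole histories\<close>

locale finite_markov_chain =
  fixes \<Omega> :: "'w measure" and m :: nat and P :: "nat \<Rightarrow> nat \<Rightarrow> real" and X :: "nat \<Rightarrow> 'w \<Rightarrow> nat"
  assumes markov_chain: "markov_chain \<Omega> m P X"
begin

sublocale prob_space \<Omega>
  using markov_chain by (simp add: markov_chain_def)

lemma measurable_X_states: "X n \<in> measurable \<Omega> (count_space {1..m})"
  using markov_chain by (simp add: markov_chain_def)

lemma measurable_X [measurable]: "X n \<in> measurable \<Omega> (count_space UNIV)"
  by (rule measurable_compose[OF measurable_X_states]) simp

lemma X_in_states: "\<omega> \<in> space \<Omega> \<Longrightarrow> X n \<omega> \<in> {1..m}"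
  using measurable_space[OF measurable_X_states] by simp

text \<open>Multiplying out the conditional probability removes the positivity condition: on a null
  history both sides are 0.\<close>

lemma prob_path_Suc:
  assumes "a \<in> {1..m}"
  shows "\<P>(\<omega> in \<Omega>. (\<forall>k\<le>n. X k \<omega> = x k) \<and> X (Suc n) \<omega> = a) =
    \<P>(\<omega> in \<Omega>. \<forall>k\<le>n. X k \<omega> = x k) * P (x n) a"
proof (cases "\<P>(\<omega> in \<Omega>. \<forall>k\<le>n. X k \<omega> = x k) > 0")
  case True
  then have "\<P>(\<omega> in \<Omega>. X (Suc n) \<omega> = a \<bar> \<forall>k\<le>n. X k \<omega> = x k) = P (x n) a"
    using markov_chain assms unfolding markov_chain_def by blast
  with True show ?thesis
    by (simp add: cond_prob_def field_simps conj_commute)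
next
  case False
  then have "\<P>(\<omega> in \<Omega>. \<forall>k\<le>n. X k \<omega> = x k) = 0"
    by (simp add: zero_less_measure_iff)
  moreover have "\<P>(\<omega> in \<Omega>. (\<forall>k\<le>n. X k \<omega> = x k) \<and> X (Suc n) \<omega> = a)
      \<le> \<P>(\<omega> in \<Omega>. \<forall>k\<le>n. X k \<omega> = x k)"
    by (intro finite_measure_mono) auto
  ultimately show ?thesis
    by (simp add: measure_le_0_iff)
qed

text \<open>The history event is a finite disjoint union of path events that all end in
  \<open>b\<close>, so \<open>P b a\<close> is a common factor of
  \<open>prob_path_Suc\<close>.\<close>

lemma prob_history_Suc:
  assumes a: "a \<in> {1..m}"
  shows "\<P>(\<omega> in \<Omega>. (\<forall>k\<le>n. X k \<omega> \<in> A k) \<and> X n \<omega> = b \<and> X (Suc n) \<omega> = a) =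
    \<P>(\<omega> in \<Omega>. (\<forall>k\<le>n. X k \<omega> \<in> A k) \<and> X n \<omega> = b) * P b a"
proof -
  \<comment> \<open>Taking extensional functions with values in the states makes \<open>H\<close>
    finite and lets each outcome of the history event match exactly one path.\<close>
  define H where "H = {x \<in> {..n} \<rightarrow>\<^sub>E {1..m}. (\<forall>k\<le>n. x k \<in> A k) \<and> x n = b}"
  have H: "x \<in> H \<Longrightarrow> k \<le> n \<Longrightarrow> x k \<in> A k" "x \<in> H \<Longrightarrow> x n = b" for x k
    by (auto simp: H_def)
  have fin: "finite H"
    unfolding H_def by (rule finite_subset[of _ "{..n} \<rightarrow>\<^sub>E {1..m}"]) (auto intro: finite_PiE)
  have unique: "\<exists>!x. x \<in> H \<and> (\<forall>k\<le>n. X k \<omega> = x k)"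
    if "\<omega> \<in> space \<Omega>" "\<forall>k\<le>n. X k \<omega> \<in> A k" "X n \<omega> = b" for \<omega>
  proof
    show "restrict (\<lambda>k. X k \<omega>) {..n} \<in> H \<and> (\<forall>k\<le>n. X k \<omega> = restrict (\<lambda>k. X k \<omega>) {..n} k)"
      using that X_in_states by (auto simp: H_def PiE_iff)
  next
    fix x assume "x \<in> H \<and> (\<forall>k\<le>n. X k \<omega> = x k)"
    then show "x = restrict (\<lambda>k. X k \<omega>) {..n}"
      by (intro extensionalityI[of _ "{..n}"]) (auto simp: H_def PiE_iff)
  qed
  have "\<P>(\<omega> in \<Omega>. (\<forall>k\<le>n. X k \<omega> \<in> A k) \<and> X n \<omega> = b \<and> X (Suc n) \<omega> = a) =
      (\<Sum>x\<in>H. \<P>(\<omega> in \<Omega>. (\<forall>k\<le>n. X k \<omega> = x k) \<and> X (Suc n) \<omega> = a))"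
    by (rule prob_sum[OF fin])
       (use unique H in \<open>auto intro!: AE_I2\<close>)
  also have "\<dots> = (\<Sum>x\<in>H. \<P>(\<omega> in \<Omega>. \<forall>k\<le>n. X k \<omega> = x k)) * P b a"
    unfolding sum_distrib_right by (rule sum.cong) (auto simp: prob_path_Suc[OF a] H_def)
  also have "(\<Sum>x\<in>H. \<P>(\<omega> in \<Omega>. \<forall>k\<le>n. X k \<omega> = x k)) =
      \<P>(\<omega> in \<Omega>. (\<forall>k\<le>n. X k \<omega> \<in> A k) \<and> X n \<omega> = b)"
    by (rule prob_sum[symmetric, OF fin])
       (use unique H in \<open>auto intro!: AE_I2\<close>)
  finally show ?thesis .
qed

text \<open>Induction on \<open>n\<close>: split by the state \<open>c\<close> at time
  \<open>l + n\<close> and apply the one-step version there. The sum over \<open>c\<close> is the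
  recursion of \<open>matrix_pow\<close>.\<close>

lemma prob_history_add:
  assumes a: "a \<in> {1..m}"
  shows "\<P>(\<omega> in \<Omega>. (\<forall>k\<le>l. X k \<omega> \<in> A k) \<and> X l \<omega> = b \<and> X (l + n) \<omega> = a) =
    \<P>(\<omega> in \<Omega>. (\<forall>k\<le>l. X k \<omega> \<in> A k) \<and> X l \<omega> = b) * matrix_pow m P n b a"
  using a
proof (induction n arbitrary: a)
  case 0
  show ?case
  proof (cases "a = b")
    case True
    then show ?thesis by simp
  next
    case False
    then have "{\<omega> \<in> space \<Omega>. (\<forall>k\<le>l. X k \<omega> \<in> A k) \<and> X l \<omega> = b \<and> X (l + 0) \<omega> = a} = {}"
      by auto
    with False show ?thesis
      by (simp only: measure_empty) simp
  qed
next
  case (Suc n)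
  \<comment> \<open>The constraints are prolonged to time \<open>l + n\<close>: \<open>b\<close> is
    absorbed at time \<open>l\<close>, and later times are left free.\<close>
  define B where "B k = (if k < l then A k else if k = l then A l \<inter> {b} else UNIV)" for k
  have B: "(\<forall>k\<le>l+n. X k \<omega> \<in> B k) \<longleftrightarrow> (\<forall>k\<le>l. X k \<omega> \<in> A k) \<and> X l \<omega> = b" for \<omega>
  proof
    assume *: "\<forall>k\<le>l+n. X k \<omega> \<in> B k"
    then have "X k \<omega> \<in> B k" if "k \<le> l" for k
      using that by simp
    then show "(\<forall>k\<le>l. X k \<omega> \<in> A k) \<and> X l \<omega> = b"
      unfolding B_def by (metis IntE le_neq_implies_less less_irrefl order_refl singletonD)
  qed (auto simp: B_def)
  have "\<P>(\<omega> in \<Omega>. (\<forall>k\<le>l. X k \<omega> \<in> A k) \<and> X l \<omega> = b \<and> X (l + Suc n) \<omega> = a) =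
    (\<Sum>c=1..m. \<P>(\<omega> in \<Omega>. (\<forall>k\<le>l+n. X k \<omega> \<in> B k) \<and> X (l+n) \<omega> = c \<and> X (Suc (l + n)) \<omega> = a))"
    unfolding B by (rule prob_sum) (use X_in_states in \<open>auto intro!: AE_I2\<close>)
  also have "\<dots> = (\<Sum>c=1..m. \<P>(\<omega> in \<Omega>. (\<forall>k\<le>l+n. X k \<omega> \<in> B k) \<and> X (l+n) \<omega> = c) * P c a)"
    by (intro sum.cong prob_history_Suc Suc.prems refl)
  also have "\<dots> = (\<Sum>c=1..m. \<P>(\<omega> in \<Omega>. (\<forall>k\<le>l. X k \<omega> \<in> A k) \<and> X l \<omega> = b) * matrix_pow m P n b c * P c a)"
    unfolding B conj_assoc by (intro sum.cong) (simp_all add: Suc.IH)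
  finally show ?case
    by (simp add: sum_distrib_left mult.assoc)
qed

lemma prob_add:
  assumes "a \<in> {1..m}"
  shows "\<P>(\<omega> in \<Omega>. X l \<omega> = b \<and> X (l + n) \<omega> = a) = \<P>(\<omega> in \<Omega>. X l \<omega> = b) * matrix_pow m P n b a"
  using prob_history_add[OF assms, of l "\<lambda>_. UNIV" b n] by simp

section \<open>Decomposition by the first passage\<close>

text \<open>
  The starting time \<open>k\<close> is a parameter because a state may have probability \<open>0\<close> at time \<open>0\<close>.
\<close>

definition first_passage :: "nat \<Rightarrow> nat \<Rightarrow> nat \<Rightarrow> nat \<Rightarrow> nat \<Rightarrow> real" where
  "first_passage k r n i j =
     \<P>(\<omega> in \<Omega>. X (k + n) \<omega> = j \<and> r \<le> n \<and> (\<forall>l\<in>{r..<n}. X (k + l) \<omega> \<noteq> j) \<bar> X k \<omega> = i)"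

text \<open>Homogeneity in time: every \<open>k\<close> at which \<open>i\<close> has positive
  probability yields the same value.\<close>

lemma matrix_pow_eq_cond_prob:
  assumes "\<P>(\<omega> in \<Omega>. X k \<omega> = i) > 0" "j \<in> {1..m}"
  shows "matrix_pow m P n i j = \<P>(\<omega> in \<Omega>. X (k + n) \<omega> = j \<bar> X k \<omega> = i)"
  using prob_add[OF assms(2), of k i n] assms(1) by (simp add: cond_prob_def conj_commute)

text \<open>Sum over the first time \<open>l\<close>, not before \<open>r\<close>, at which
  \<open>j\<close> is visited; from then on the chain restarts at \<open>j\<close>. The bound
  \<open>r \<le> n\<close> makes the visit at time \<open>n\<close> itself a candidate, so such an
  \<open>l\<close> exists.\<close>

lemma matrix_pow_first_passage:
  assumes pos: "\<P>(\<omega> in \<Omega>. X k \<omega> = i) > 0" and j: "j \<in> {1..m}" and "r \<le> n"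
  shows "matrix_pow m P n i j = (\<Sum>l\<le>n. first_passage k r l i j * matrix_pow m P (n - l) j j)"
proof -
  define F where "F l \<omega> \<longleftrightarrow> X (k + l) \<omega> = j \<and> r \<le> l \<and> (\<forall>q\<in>{r..<l}. X (k + q) \<omega> \<noteq> j)" for l \<omega>
  have [measurable]: "Measurable.pred \<Omega> (F l)" for l
    unfolding F_def by measurable
  have ex1: "\<exists>!l. l \<le> n \<and> F l \<omega>" if "X (k + n) \<omega> = j" for \<omega>
  proof -
    define l where "l = (LEAST l. r \<le> l \<and> X (k + l) \<omega> = j)"
    have l: "r \<le> l \<and> X (k + l) \<omega> = j"
      unfolding l_def by (rule LeastI[of _ n]) (use that \<open>r \<le> n\<close> in simp)
    have le: "l \<le> q" if "r \<le> q" "X (k + q) \<omega> = j" for q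
      unfolding l_def by (rule Least_le) (use that in simp)
    have "l \<le> n \<and> F l \<omega>"
      using l le that \<open>r \<le> n\<close> by (fastforce simp: F_def)
    moreover have "q = l" if "F q \<omega>" for q
    proof (rule ccontr)
      assume "q \<noteq> l"
      moreover have "r \<le> q" "X (k + q) \<omega> = j" and *: "\<And>p. p \<in> {r..<q} \<Longrightarrow> X (k + p) \<omega> \<noteq> j"
        using that by (auto simp: F_def)
      ultimately have "l \<in> {r..<q}"
        using le[of q] l by simp
      with * l show False by blast
    qed
    ultimately show ?thesis by blast
  qed
  have "\<P>(\<omega> in \<Omega>. X k \<omega> = i \<and> X (k + n) \<omega> = j) =
      (\<Sum>l\<le>n. \<P>(\<omega> in \<Omega>. X k \<omega> = i \<and> F l \<omega> \<and> X (k + n) \<omega> = j))"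
    by (rule prob_sum) (use ex1 in \<open>auto intro!: AE_I2\<close>)
  also have "\<dots> = (\<Sum>l\<le>n. \<P>(\<omega> in \<Omega>. X k \<omega> = i \<and> F l \<omega>) * matrix_pow m P (n - l) j j)"
  proof (rule sum.cong[OF refl])
    fix l assume "l \<in> {..n}"
    \<comment> \<open>The event is rewritten as one constraint per absolute time, as
      \<open>prob_history_add\<close> demands: state \<open>i\<close> at \<open>k\<close>, no
      \<open>j\<close> from \<open>k + r\<close> until just before \<open>k + l\<close>. The
      condition \<open>r \<le> l\<close> is encoded by making every \<open>A q\<close> empty when it
      fails.\<close>
    define A where "A q = (if q = k then {i} else UNIV) \<inter> (if k + r \<le> q \<and> q < k + l then - {j} else UNIV)
      \<inter> (if r \<le> l then UNIV else {})" for q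
    have A: "X k \<omega> = i \<and> F l \<omega> \<longleftrightarrow> (\<forall>q\<le>k+l. X q \<omega> \<in> A q) \<and> X (k + l) \<omega> = j" for \<omega>
    proof
      assume "X k \<omega> = i \<and> F l \<omega>"
      moreover have "X q \<omega> \<noteq> j" if "k + r \<le> q" "q < k + l" "F l \<omega>" for q
        using that by (auto simp: F_def dest!: bspec[of _ _ "q - k"])
      ultimately show "(\<forall>q\<le>k+l. X q \<omega> \<in> A q) \<and> X (k + l) \<omega> = j"
        by (auto simp: A_def F_def)
    next
      assume *: "(\<forall>q\<le>k+l. X q \<omega> \<in> A q) \<and> X (k + l) \<omega> = j"
      then have "X k \<omega> \<in> A k" and q: "\<And>q. q \<le> l \<Longrightarrow> X (k + q) \<omega> \<in> A (k + q)"
        by auto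
      then have "X k \<omega> = i" "r \<le> l"
        by (auto simp: A_def split: if_splits)
      moreover have "X (k + p) \<omega> \<noteq> j" if "p \<in> {r..<l}" for p
        using q[of p] that by (simp add: A_def)
      ultimately show "X k \<omega> = i \<and> F l \<omega>"
        using * by (simp add: F_def)
    qed
    show "\<P>(\<omega> in \<Omega>. X k \<omega> = i \<and> F l \<omega> \<and> X (k + n) \<omega> = j) =
        \<P>(\<omega> in \<Omega>. X k \<omega> = i \<and> F l \<omega>) * matrix_pow m P (n - l) j j"
      using prob_history_add[OF j, of "k + l" A j "n - l"] \<open>l \<in> {..n}\<close>
      by (simp only: A conj_assoc[symmetric] add.assoc le_add_diff_inverse atMost_iff)
  qed
  finally have "matrix_pow m P n i j =
      (\<Sum>l\<le>n. \<P>(\<omega> in \<Omega>. X k \<omega> = i \<and> F l \<omega>) / \<P>(\<omega> in \<Omega>. X k \<omega> = i) * matrix_pow m P (n - l) j j)"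
    unfolding matrix_pow_eq_cond_prob[OF pos j, of n] cond_prob_def
    by (simp add: conj_commute sum_divide_distrib)
  moreover have "first_passage k r l i j = \<P>(\<omega> in \<Omega>. X k \<omega> = i \<and> F l \<omega>) / \<P>(\<omega> in \<Omega>. X k \<omega> = i)" for l
    unfolding first_passage_def cond_prob_def F_def by (simp only: conj_ac)
  ultimately show ?thesis
    by simp
qed

end

section \<open>Generating functions of first passages and of the mixing time\<close>

lemma summable_bounded_coeffs_power:
  fixes s :: "'a::{real_normed_field, banach}"
  assumes "norm s < 1" and "\<And>n. 0 \<le> c n" and "\<And>n. c n \<le> 1"
  shows "summable (\<lambda>n. norm (of_real (c n) * s ^ n))"
proof (rule summable_comparison_test')
  show "summable (\<lambda>n. norm s ^ n)"
    using assms(1) by (simp add: summable_geometric)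
  show "norm (norm (of_real (c n) * s ^ n)) \<le> norm s ^ n" for n
    using assms(2)[of n] assms(3)[of n] by (simp add: norm_mult norm_power mult_left_le_one_le)
qed

text \<open>The bounds hold also for a null condition, where the quotient is 0 by the convention on
  division.\<close>

lemma cond_prob_bounds:
  assumes "prob_space M" "{x \<in> space M. B x} \<in> sets M"
  shows "0 \<le> \<P>(x in M. A x \<bar> B x)" "\<P>(x in M. A x \<bar> B x) \<le> 1"
proof -
  interpret prob_space M by fact
  have "\<P>(x in M. A x \<and> B x) \<le> \<P>(x in M. B x)"
    by (rule finite_measure_mono) (use assms in auto)
  then show "\<P>(x in M. A x \<bar> B x) \<le> 1"
    unfolding cond_prob_def by (intro divide_le_eq_1[THEN iffD2]) (auto simp: less_le)
qed (simp add: cond_prob_def)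

context finite_markov_chain
begin

definition first_passage_gf :: "nat \<Rightarrow> nat \<Rightarrow> nat \<Rightarrow> nat \<Rightarrow> 'a::{real_normed_field, banach} \<Rightarrow> 'a" where
  "first_passage_gf k r i j s = (\<Sum>n. of_real (first_passage k r n i j) * s ^ n)"

lemma summable_first_passage:
  fixes s :: "'a::{real_normed_field, banach}"
  assumes "norm s < 1"
  shows "summable (\<lambda>n. norm (of_real (first_passage k r n i j) * s ^ n))"
  unfolding first_passage_def
  by (intro summable_bounded_coeffs_power assms cond_prob_bounds prob_space_axioms) simp_all

text \<open>Split by the value \<open>j\<close> of \<open>M\<close>. On \<open>M = j\<close> the
  mixing time is a passage time to \<open>j\<close>, an event of the chain alone, so independence
  yields the factor \<open>\<pi> j\<close>.\<close>

lemma prob_mixing_time: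
  assumes M: "mixing_variable \<Omega> m X \<pi> M"
  shows "\<P>(\<omega> in \<Omega>. mixing_time X M r \<omega> = enat n \<bar> X 0 \<omega> = i) =
    (\<Sum>j=1..m. \<pi> j * first_passage 0 r n i j)"
proof -
  have M_states: "M \<in> measurable \<Omega> (count_space {1..m})"
    using M by (simp add: mixing_variable_def)
  have [measurable]: "M \<in> measurable \<Omega> (count_space UNIV)"
    by (rule measurable_compose[OF M_states]) simp
  \<comment> \<open>\<open>F j\<close> is a property of trajectories, so that it defines a set of
    the product sigma-algebra. It includes \<open>x 0 = i\<close> because independence is applied
    before conditioning.\<close>
  define F where "F j x \<longleftrightarrow> x n = j \<and> r \<le> n \<and> (\<forall>l\<in>{r..<n}. x l \<noteq> j) \<and> x 0 = i"
    for j and x :: "nat \<Rightarrow> nat"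
  have F_meas: "{x \<in> space (Pi\<^sub>M UNIV (\<lambda>_::nat. count_space {1..m})). F j x}
      \<in> sets (Pi\<^sub>M UNIV (\<lambda>_::nat. count_space {1..m}))" for j
    unfolding F_def by measurable
  have F_eq: "{\<omega> \<in> space \<Omega>. F j (\<lambda>n. X n \<omega>)} = (\<lambda>\<omega> n. X n \<omega>) -`
      {x \<in> space (Pi\<^sub>M UNIV (\<lambda>_::nat. count_space {1..m})). F j x} \<inter> space \<Omega>" for j
    using X_in_states by (auto simp: space_PiM)
  have [measurable]: "Measurable.pred \<Omega> (\<lambda>\<omega>. F j (\<lambda>n. X n \<omega>))" for j
    unfolding F_def by measurable
  have T: "mixing_time X M r \<omega> = enat n \<and> X 0 \<omega> = i \<longleftrightarrow> F (M \<omega>) (\<lambda>n. X n \<omega>)" for \<omega>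
  proof -
    let ?S = "{enat k |k. r \<le> k \<and> X k \<omega> = M \<omega>}"
    \<comment> \<open>The infimum of the empty set is \<open>\<infinity>\<close>; a finite value
      therefore forces \<open>?S\<close> to be nonempty, and by well-ordering the infimum is then
      attained.\<close>
    have "Inf ?S = enat n \<longleftrightarrow> enat n \<in> ?S \<and> (\<forall>y\<in>?S. enat n \<le> y)"
    proof
      assume *: "Inf ?S = enat n"
      then have "?S \<noteq> {}"
        unfolding Inf_enat_def by (metis enat.distinct(1))
      then have "Inf ?S \<in> ?S"
        unfolding Inf_enat_def by (auto intro: LeastI)
      moreover have "Inf ?S \<le> y" if "y \<in> ?S" for y
        using that by (rule Inf_lower)
      ultimately show "enat n \<in> ?S \<and> (\<forall>y\<in>?S. enat n \<le> y)"
        unfolding * by blast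
    next
      assume "enat n \<in> ?S \<and> (\<forall>y\<in>?S. enat n \<le> y)"
      then show "Inf ?S = enat n"
        by (intro antisym Inf_lower Inf_greatest) blast+
    qed
    also have "\<dots> \<longleftrightarrow> X n \<omega> = M \<omega> \<and> r \<le> n \<and> (\<forall>l\<in>{r..<n}. X l \<omega> \<noteq> M \<omega>)"
      by (auto simp: Ball_def)
    finally show ?thesis
      unfolding mixing_time_def F_def by simp
  qed
  have indep: "\<P>(\<omega> in \<Omega>. M \<omega> = j \<and> F j (\<lambda>n. X n \<omega>)) = \<pi> j * \<P>(\<omega> in \<Omega>. F j (\<lambda>n. X n \<omega>))"
    if "j \<in> {1..m}" for j
  proof -
    have "{\<omega> \<in> space \<Omega>. M \<omega> = j} = M -` {j} \<inter> space \<Omega>"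
      by auto
    then have 1: "{\<omega> \<in> space \<Omega>. M \<omega> = j} \<in> sets (vimage_algebra (space \<Omega>) M (count_space {1..m}))"
      using that by (auto intro: in_vimage_algebra)
    have 2: "{\<omega> \<in> space \<Omega>. F j (\<lambda>n. X n \<omega>)} \<in> sets (vimage_algebra (space \<Omega>) (\<lambda>\<omega> n. X n \<omega>)
         (Pi\<^sub>M UNIV (\<lambda>_::nat. count_space {1..m})))"
      unfolding F_eq using F_meas by (rule in_vimage_algebra)
    have "prob ({\<omega> \<in> space \<Omega>. M \<omega> = j} \<inter> {\<omega> \<in> space \<Omega>. F j (\<lambda>n. X n \<omega>)}) =
        \<P>(\<omega> in \<Omega>. M \<omega> = j) * \<P>(\<omega> in \<Omega>. F j (\<lambda>n. X n \<omega>))"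
      by (rule indep_setD[OF _ 1 2]) (use M in \<open>simp add: mixing_variable_def\<close>)
    moreover have "\<P>(\<omega> in \<Omega>. M \<omega> = j) = \<pi> j"
      using M that by (simp add: mixing_variable_def)
    moreover have "{\<omega> \<in> space \<Omega>. M \<omega> = j \<and> F j (\<lambda>n. X n \<omega>)} =
        {\<omega> \<in> space \<Omega>. M \<omega> = j} \<inter> {\<omega> \<in> space \<Omega>. F j (\<lambda>n. X n \<omega>)}"
      by auto
    ultimately show ?thesis
      by (simp only:)
  qed
  have "\<P>(\<omega> in \<Omega>. mixing_time X M r \<omega> = enat n \<and> X 0 \<omega> = i) =
      (\<Sum>j=1..m. \<P>(\<omega> in \<Omega>. M \<omega> = j \<and> F j (\<lambda>n. X n \<omega>)))"
    unfolding T
    by (rule prob_sum) (use measurable_space[OF M_states] in \<open>auto intro!: AE_I2\<close>)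
  also have "\<dots> = (\<Sum>j=1..m. \<pi> j * \<P>(\<omega> in \<Omega>. F j (\<lambda>n. X n \<omega>)))"
    by (intro sum.cong refl indep)
  \<comment> \<open>It remains to divide by the probability of \<open>X 0 = i\<close>; if that is 0,
    both sides are 0.\<close>
  finally show ?thesis
    by (simp add: cond_prob_def first_passage_def F_def sum_divide_distrib conj_assoc)
qed

lemma mixing_pgf_eq:
  fixes s :: "'a::{real_normed_field, banach}"
  assumes M: "mixing_variable \<Omega> m X \<pi> M" and s: "norm s < 1"
  shows "mixing_pgf \<Omega> X M r i s = (\<Sum>j=1..m. of_real (\<pi> j) * first_passage_gf 0 r i j s)"
proof -
  have sm: "summable (\<lambda>n. of_real (first_passage 0 r n i j) * s ^ n)" for j
    by (rule summable_norm_cancel[OF summable_first_passage[OF s]])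
  have "mixing_pgf \<Omega> X M r i s =
      (\<Sum>n. \<Sum>j=1..m. of_real (\<pi> j) * (of_real (first_passage 0 r n i j) * s ^ n))"
    unfolding mixing_pgf_def prob_mixing_time[OF M] by (simp add: sum_distrib_right mult.assoc)
  also have "\<dots> = (\<Sum>j=1..m. \<Sum>n. of_real (\<pi> j) * (of_real (first_passage 0 r n i j) * s ^ n))"
    by (intro suminf_sum summable_mult sm)
  also have "\<dots> = (\<Sum>j=1..m. of_real (\<pi> j) * first_passage_gf 0 r i j s)"
    unfolding first_passage_gf_def by (intro sum.cong refl suminf_mult sm)
  finally show ?thesis .
qed

end

section \<open>Renewal identities for an irreducible chain\<close>

locale irreducible_markov_chain = finite_markov_chain \<Omega> m P X
  for \<Omega> :: "'w measure" and m P X +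
  assumes irreducible: "irreducible_chain \<Omega> m X"
begin

text \<open>A positive \<open>trans_prob\<close> has a positive denominator, so irreducibility,
  applied to the pair \<open>i\<close>, \<open>i\<close>, excludes states that are never
  visited.\<close>

lemma ex_visit_time:
  assumes "i \<in> {1..m}"
  shows "\<exists>k. \<P>(\<omega> in \<Omega>. X k \<omega> = i) > 0"
proof -
  obtain n where "trans_prob \<Omega> X n i i > 0"
    using irreducible assms unfolding irreducible_chain_def by blast
  then show ?thesis
    by (auto simp: trans_prob_def Let_def cond_prob_def zero_less_divide_iff)
qed

text \<open>By \<open>ex_visit_time\<close> the \<open>LEAST\<close> in \<open>trans_prob\<close> is
  a time at which \<open>i\<close> has positive probability, so homogeneity applies.\<close>

lemma trans_prob_eq_matrix_pow:
  assumes "i \<in> {1..m}" "j \<in> {1..m}"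
  shows "trans_prob \<Omega> X n i j = matrix_pow m P n i j"
  using matrix_pow_eq_cond_prob[OF LeastI_ex[OF ex_visit_time[OF assms(1)]] assms(2)]
  by (simp add: trans_prob_def Let_def)

lemma summable_trans_prob:
  fixes s :: "'a::{real_normed_field, banach}"
  assumes "norm s < 1"
  shows "summable (\<lambda>n. norm (of_real (trans_prob \<Omega> X n i j) * s ^ n))"
  unfolding trans_prob_def Let_def
  by (intro summable_bounded_coeffs_power assms cond_prob_bounds prob_space_axioms) simp_all

text \<open>The first-passage decomposition is a convolution of coefficients; absolute convergence
  turns it into a Cauchy product.\<close>

lemma trans_gf_first_passage:
  fixes s :: "'a::{real_normed_field, banach}"
  assumes i: "i \<in> {1..m}" and j: "j \<in> {1..m}" and pos: "\<P>(\<omega> in \<Omega>. X k \<omega> = i) > 0"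
    and s: "norm s < 1" and r: "r \<le> 1"
  shows "trans_gf \<Omega> X i j s =
    (if r = 1 \<and> i = j then 1 else 0) + first_passage_gf k r i j s * trans_gf \<Omega> X j j s"
proof -
  let ?f = "\<lambda>n. of_real (first_passage k r n i j) * s ^ n"
  let ?p = "\<lambda>i n. of_real (trans_prob \<Omega> X n i j) * s ^ n"
  \<comment> \<open>The correction sits only in the constant coefficient: for \<open>r = 1\<close> a
    visit at time 0 is not counted as a passage, yet it contributes to \<open>trans_prob\<close>
    when \<open>i = j\<close>.\<close>
  let ?d = "\<lambda>n. if n = 0 then (if r = 1 \<and> i = j then 1 else 0) else 0 :: 'a"
  have "?p i n = ?d n + (\<Sum>l\<le>n. ?f l * ?p j (n - l))" for n
  proof -
    have "trans_prob \<Omega> X n i j = (if n = 0 \<and> r = 1 \<and> i = j then 1 else 0) +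
        (\<Sum>l\<le>n. first_passage k r l i j * trans_prob \<Omega> X (n - l) j j)"
    proof (cases "r \<le> n")
      case True
      then have "\<not> (n = 0 \<and> r = 1 \<and> i = j)" by simp
      then show ?thesis
        using matrix_pow_first_passage[OF pos j True]
        by (simp only: trans_prob_eq_matrix_pow i j if_False add_0)
    next
      case False
      \<comment> \<open>Here the only summand has \<open>l = 0 < r\<close>, so the first-passage
        probability is 0 and just the Kronecker delta remains.\<close>
      then have "n = 0" "r = 1" using r by auto
      then show ?thesis
        by (simp add: trans_prob_eq_matrix_pow[OF i j] first_passage_def cond_prob_def)
    qed
    moreover have "(\<Sum>l\<le>n. ?f l * ?p j (n - l)) =
        of_real (\<Sum>l\<le>n. first_passage k r l i j * trans_prob \<Omega> X (n - l) j j) * s ^ n"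
      unfolding of_real_sum sum_distrib_right
    proof (rule sum.cong[OF refl])
      fix l assume "l \<in> {..n}"
      then have "s ^ n = s ^ l * s ^ (n - l)"
        by (simp flip: power_add)
      then show "?f l * ?p j (n - l) =
          of_real (first_passage k r l i j * trans_prob \<Omega> X (n - l) j j) * s ^ n"
        by (simp add: mult_ac)
    qed
    ultimately show ?thesis
      by (simp only: of_real_add distrib_right) simp
  qed
  moreover have "(\<lambda>n. \<Sum>l\<le>n. ?f l * ?p j (n - l)) sums
      (first_passage_gf k r i j s * trans_gf \<Omega> X j j s)"
    unfolding first_passage_gf_def trans_gf_def
    by (intro Cauchy_product_sums summable_first_passage summable_trans_prob s)
  moreover have "?d sums (if r = 1 \<and> i = j then 1 else 0)"
    using sums_single[of 0 "\<lambda>_. if r = 1 \<and> i = j then 1 else 0 :: 'a"] by simp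
  ultimately have "?p i sums
      ((if r = 1 \<and> i = j then 1 else 0) + first_passage_gf k r i j s * trans_gf \<Omega> X j j s)"
    by (simp only: sums_add)
  then show ?thesis
    unfolding trans_gf_def by (rule sums_unique[symmetric])
qed

text \<open>If the value were 0, the identity for \<open>r = 1\<close> and \<open>i = j\<close>
  would read \<open>0 = 1\<close>. The time \<open>k\<close> is one at which \<open>j\<close> has
  positive probability, which need not be 0.\<close>

lemma trans_gf_nonzero:
  fixes s :: "'a::{real_normed_field, banach}"
  assumes j: "j \<in> {1..m}" and s: "norm s < 1"
  shows "trans_gf \<Omega> X j j s \<noteq> 0"
proof -
  obtain k where "\<P>(\<omega> in \<Omega>. X k \<omega> = j) > 0"
    using ex_visit_time[OF j] by blast
  from trans_gf_first_passage[OF j j this s, of 1] show ?thesis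
    by auto
qed

end

section \<open>Generating functions of the two mixing times\<close>

theorem theorem2p6:
  fixes \<Omega> :: "'w measure" and X :: "nat \<Rightarrow> 'w \<Rightarrow> nat" and M :: "'w \<Rightarrow> nat"
    and m i :: nat and P :: "nat \<Rightarrow> nat \<Rightarrow> real" and \<pi> :: "nat \<Rightarrow> real"
    and s :: "'a::{real_normed_field, banach}"
  assumes "markov_chain \<Omega> m P X"
    and "irreducible_chain \<Omega> m X"
    and "stationary_distribution m P \<pi>"
    and "mixing_variable \<Omega> m X \<pi> M"
    and "i \<in> {1..m}"
    and "\<P>(\<omega> in \<Omega>. X 0 \<omega> = i) > 0"
    and "norm s < 1"
  shows "mixing_pgf \<Omega> X M 0 i s =
           (\<Sum>j=1..m. of_real (\<pi> j) * (trans_gf \<Omega> X i j s / trans_gf \<Omega> X j j s)) \<and>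
         mixing_pgf \<Omega> X M 1 i s =
           mixing_pgf \<Omega> X M 0 i s - of_real (\<pi> i) / trans_gf \<Omega> X i i s"
proof -
  interpret irreducible_markov_chain \<Omega> m P X
    using assms(1,2) by unfold_locales
  have gf: "first_passage_gf 0 r i j s =
      (trans_gf \<Omega> X i j s - (if r = 1 \<and> i = j then 1 else 0)) / trans_gf \<Omega> X j j s"
    if "j \<in> {1..m}" "r \<le> 1" for j r
    using trans_gf_first_passage[OF assms(5) that(1) assms(6,7) that(2)]
      trans_gf_nonzero[OF that(1) assms(7)]
    by (simp add: eq_divide_eq)
  have f: "mixing_pgf \<Omega> X M 0 i s =
      (\<Sum>j=1..m. of_real (\<pi> j) * (trans_gf \<Omega> X i j s / trans_gf \<Omega> X j j s))"
    unfolding mixing_pgf_eq[OF assms(4,7)] by (intro sum.cong) (simp_all add: gf)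
  \<comment> \<open>For \<open>r = 1\<close> the Kronecker delta in \<open>gf\<close> affects only
    the summand \<open>j = i\<close>, and this is the subtracted term.\<close>
  have "mixing_pgf \<Omega> X M 1 i s =
      (\<Sum>j=1..m. of_real (\<pi> j) * (trans_gf \<Omega> X i j s / trans_gf \<Omega> X j j s) -
        (if j = i then of_real (\<pi> i) / trans_gf \<Omega> X i i s else 0))"
    unfolding mixing_pgf_eq[OF assms(4,7)]
    by (intro sum.cong) (auto simp: gf diff_divide_distrib right_diff_distrib)
  also have "\<dots> = mixing_pgf \<Omega> X M 0 i s - of_real (\<pi> i) / trans_gf \<Omega> X i i s"
    using assms(5) by (simp add: f sum_subtractf)
  finally show ?thesis
    using f by blast
qed

end
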